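(* Let $n\ge 1$ and let $\Phi=\{\phi_m\}_{m=1}^M\subseteq\{e_i\}_{i=1}^n\cup\{e_i-e_j\}_{1\le i<j\le n}$ be an ensemble, with complex-valued intensity map $\mathcal{B}:\mathbb{C}^n/\{\pm1\}\to\mathbb{C}^M$, $(\mathcal{B}(x))_m=\langle x,\phi_m\rangle^2$, and associated graph $G=G_\Phi=(V,E_\Phi)$ on $V=\{0,1,\dots,n\}$. If $\mathcal{B}$ is injective on the set of generic points of $\mathbb{C}^n/\{\pm1\}$, in the sense that for every generic $x\in\mathbb{C}^n$ the preimage $\mathcal{B}^{-1}(\mathcal{B}(x))$ is the single point $[x]=\{\pm x\}\in\mathbb{C}^n/\{\pm1\}$, then $G$ is generically globally rigid on $\mathbb{C}$, and hence also generically globally rigid on $\mathbb{R}$.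
   Context: Notation: $e_i$ is the $i$-th standard basis vector of $\mathbb{C}^n$, and $\langle x,\phi\rangle=\phi^Hx$, so $\langle x,e_i\rangle^2=x_i^2$ and $\langle x,e_i-e_j\rangle^2=(x_i-x_j)^2$. $\mathbb{C}^n/\{\pm1\}$ is the quotient of $\mathbb{C}^n$ identifying $x$ with $-x$. Graph: $G_\Phi=(V,E_\Phi)$ has vertex set $V=\{0,1,\dots,n\}$. Its edges are the pairs $(i,0)$ with $e_i\in\Phi$ and the pairs $(i,j)$, $1\le i<j\le n$, with $e_i-e_j\in\Phi$. Genericity: a vector $x\in\mathbb{C}^n$ is generic if its coordinates do not satisfy any non-zero polynomial equation with rational coefficients (they are algebraically independent over $\mathbb{Q}$). A point $[x]\in\mathbb{C}^n/\{\pm1\}$ is generic if $x$ is. Rigidity on $\mathbb{K}\in\{\mathbb{C},\mathbb{R}\}$: for $w,z\in\mathbb{K}$ let $c(w,z)=(w-z)^2$. A configuration is a map $p:V\to\mathbb{K}$, and $(G,p)$ is a framework. The configuration (and the framework) is generic if the values $p(0),p(1),\dots,p(n)$ are algebraically independent over $\mathbb{Q}$. Frameworks $(G,p)$ and $(G,q)$ are equivalent if $c(p(i),p(j))=c(q(i),q(j))$ for all edges $(i,j)$ of $G$. Configurations $p,q$ are congruent if $c(p(i),p(j))=c(q(i),q(j))$ for all $i,j\in V$. $(G,p)$ is globally rigid if for every $(G,q)$ equivalent to it (with $q:V\to\mathbb{K}$), $p$ and $q$ are congruent. $G$ is generically globally rigid on $\mathbb{K}$ if all generic frameworks $(G,p)$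 with $p:V\to\mathbb{K}$ are globally rigid. *)

theory Defs
  imports
    "HOL-Library.Poly_Mapping"
    "Jordan_Normal_Form.Matrix"
begin

text \<open>
  A polynomial with rational coefficients in variables indexed by \<^typ>\<open>'i\<close> is a finitely
  supported map from monomials (finitely supported exponent maps) to \<^typ>\<open>rat\<close>.
\<close>

type_synonym 'i rat_mpoly = "('i \<Rightarrow>\<^sub>0 nat) \<Rightarrow>\<^sub>0 rat"

definition mpoly_vars :: "'i rat_mpoly \<Rightarrow> 'i set" where
  "mpoly_vars P = (\<Union>m\<in>Poly_Mapping.keys P. Poly_Mapping.keys m)"

definition mpoly_eval :: "('i \<Rightarrow> 'a::field_char_0) \<Rightarrow> 'i rat_mpoly \<Rightarrow> 'a" where
  "mpoly_eval x P =
     (\<Sum>m\<in>Poly_Mapping.keys P. of_rat (Poly_Mapping.lookup P m) *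
        (\<Prod>i\<in>Poly_Mapping.keys m. x i ^ Poly_Mapping.lookup m i))"

definition alg_indep_rat :: "'i set \<Rightarrow> ('i \<Rightarrow> 'a::field_char_0) \<Rightarrow> bool" where
  "alg_indep_rat I x \<longleftrightarrow>
     (\<forall>P. mpoly_vars P \<subseteq> I \<and> P \<noteq> 0 \<longrightarrow> mpoly_eval x P \<noteq> 0)"

text \<open>
  A graph is a pair of a vertex set and a set of edges. Every edge of an undirected graph is
  listed in (at least) one orientation; all notions below are insensitive to the orientation,
  since \<open>sq_dist\<close> is symmetric. Only the values of a configuration on the vertex set matter.
\<close>

type_synonym 'v pgraph = "'v set \<times> ('v \<times> 'v) set"

definition sq_dist :: "'a::field_char_0 \<Rightarrow> 'a \<Rightarrow> 'a" where
  "sq_dist w z = (w - z)\<^sup>2"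

definition generic_config :: "'v pgraph \<Rightarrow> ('v \<Rightarrow> 'a::field_char_0) \<Rightarrow> bool" where
  "generic_config G p \<longleftrightarrow> alg_indep_rat (fst G) p"

definition equivalent_frameworks ::
    "'v pgraph \<Rightarrow> ('v \<Rightarrow> 'a::field_char_0) \<Rightarrow> ('v \<Rightarrow> 'a) \<Rightarrow> bool" where
  "equivalent_frameworks G p q \<longleftrightarrow>
     (\<forall>(i, j)\<in>snd G. sq_dist (p i) (p j) = sq_dist (q i) (q j))"

definition congruent_configs ::
    "'v pgraph \<Rightarrow> ('v \<Rightarrow> 'a::field_char_0) \<Rightarrow> ('v \<Rightarrow> 'a) \<Rightarrow> bool" where
  "congruent_configs G p q \<longleftrightarrow>
     (\<forall>i\<in>fst G. \<forall>j\<in>fst G. sq_dist (p i) (p j) = sq_dist (q i) (q j))"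

definition globally_rigid :: "'v pgraph \<Rightarrow> ('v \<Rightarrow> 'a::field_char_0) \<Rightarrow> bool" where
  "globally_rigid G p \<longleftrightarrow>
     (\<forall>q. equivalent_frameworks G p q \<longrightarrow> congruent_configs G p q)"

definition generically_globally_rigid :: "'a::field_char_0 itself \<Rightarrow> 'v pgraph \<Rightarrow> bool" where
  "generically_globally_rigid K G \<longleftrightarrow>
     (\<forall>p :: 'v \<Rightarrow> 'a. generic_config G p \<longrightarrow> globally_rigid G p)"

text \<open>
  Vectors are indexed from \<open>0\<close>, so the \<open>i\<close>-th standard basis vector, for \<open>1 \<le> i \<le> n\<close>, is
  \<^term>\<open>unit_vec n (i - 1)\<close>.
\<close>

definition std_basis :: "nat \<Rightarrow> nat \<Rightarrow> complex vec" where
  "std_basis n i = unit_vec n (i - 1)"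

definition edge_vectors :: "nat \<Rightarrow> complex vec set" where
  "edge_vectors n =
     {std_basis n i | i. 1 \<le> i \<and> i \<le> n} \<union>
     {std_basis n i - std_basis n j | i j. 1 \<le> i \<and> i < j \<and> j \<le> n}"

definition ensemble_graph :: "nat \<Rightarrow> complex vec set \<Rightarrow> nat pgraph" where
  "ensemble_graph n \<Phi> =
     ({0..n},
      {(i, 0) | i. 1 \<le> i \<and> i \<le> n \<and> std_basis n i \<in> \<Phi>} \<union>
      {(i, j) | i j. 1 \<le> i \<and> i < j \<and> j \<le> n \<and> std_basis n i - std_basis n j \<in> \<Phi>})"

definition pm_rel :: "nat \<Rightarrow> (complex vec \<times> complex vec) set" where
  "pm_rel n = {(x, y). x \<in> carrier_vec n \<and> y \<in> carrier_vec n \<and> (y = x \<or> y = - x)}"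

definition pm_class :: "nat \<Rightarrow> complex vec \<Rightarrow> complex vec set" where
  "pm_class n x = pm_rel n `` {x}"

definition pm_space :: "nat \<Rightarrow> complex vec set set" where
  "pm_space n = carrier_vec n // pm_rel n"

text \<open>
  The ensemble is the family \<open>\<phi> 0, \<dots>, \<phi> (M - 1)\<close>. The product \<^term>\<open>x \<bullet>c y\<close> conjugates its
  second argument.
\<close>

definition intensity_vec ::
    "nat \<Rightarrow> (nat \<Rightarrow> complex vec) \<Rightarrow> complex vec \<Rightarrow> complex vec" where
  "intensity_vec M \<phi> x = vec M (\<lambda>m. (x \<bullet>c \<phi> m)\<^sup>2)"

text \<open>
  The induced map on sign classes sends a class to the common value of \<^const>\<open>intensity_vec\<close>
  on its elements; see \<open>intensity_pm_class\<close> below.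
\<close>

definition intensity ::
    "nat \<Rightarrow> (nat \<Rightarrow> complex vec) \<Rightarrow> complex vec set \<Rightarrow> complex vec" where
  "intensity M \<phi> c = the_elem (intensity_vec M \<phi> ` c)"

lemma equiv_pm_rel: "equiv (carrier_vec n) (pm_rel n)"
  unfolding equiv_def refl_on_def sym_def trans_def pm_rel_def by auto

lemma pm_class_eq: "x \<in> carrier_vec n \<Longrightarrow> pm_class n x = {x, - x}"
  unfolding pm_class_def pm_rel_def by auto

lemma intensity_pm_class:
  assumes "x \<in> carrier_vec n" "\<And>m. m < M \<Longrightarrow> \<phi> m \<in> carrier_vec n"
  shows "intensity M \<phi> (pm_class n x) = intensity_vec M \<phi> x"
proof -
  have "(- x \<bullet>c \<phi> m)\<^sup>2 = (x \<bullet>c \<phi> m)\<^sup>2" if "m < M" for m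
  proof -
    have "- x \<bullet>c \<phi> m = - (x \<bullet>c \<phi> m)"
      using assms(1) assms(2)[OF that] by (intro uminus_scalar_prod[symmetric]) auto
    then show ?thesis by simp
  qed
  then have "intensity_vec M \<phi> (- x) = intensity_vec M \<phi> x"
    unfolding intensity_vec_def by (intro eq_vecI) auto
  then show ?thesis
    unfolding intensity_def pm_class_eq[OF assms(1)] by simp
qed

definition generic_vec :: "nat \<Rightarrow> complex vec \<Rightarrow> bool" where
  "generic_vec n x \<longleftrightarrow> x \<in> carrier_vec n \<and> alg_indep_rat {..<n} (\<lambda>i. x $ i)"

definition injective_on_generic :: "nat \<Rightarrow> nat \<Rightarrow> (nat \<Rightarrow> complex vec) \<Rightarrow> bool" where
  "injective_on_generic n M \<phi> \<longleftrightarrow>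
     (\<forall>x. generic_vec n x \<longrightarrow>
        {c \<in> pm_space n. intensity M \<phi> c = intensity M \<phi> (pm_class n x)} = {pm_class n x})"

end

theory Submission
  imports Defs
begin

text \<open>
  Pin the vertex \<open>0\<close> at the origin: a configuration \<open>p\<close> becomes the vector \<open>x\<close> with entries
  \<open>p i - p 0\<close>, and the squared length of an edge of \<open>G\<close> becomes the intensity \<open>\<langle>x, \<phi>\<rangle>\<^sup>2\<close> at the
  ensemble vector of that edge. Equivalent frameworks thus give vectors \<open>x\<close>, \<open>y\<close> with equal
  intensities. If \<open>x\<close> is generic, injectivity yields \<open>y = x\<close> or \<open>y = - x\<close>, and either way all
  squared differences of the two configurations agree.

  What needs an argument is that \<open>x\<close> is generic when \<open>p\<close> is (\<open>alg_indep_rat_differences\<close>).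
  Substituting \<open>X\<^sub>i - X\<^sub>0\<close> for \<open>X\<^sub>i\<close> turns a relation \<open>P\<close> between the \<open>p i - p 0\<close> into a relation
  \<open>Q\<close> between the \<open>p i\<close>, so \<open>Q = 0\<close> by genericity of \<open>p\<close>. But \<open>Q\<close> returns \<open>P\<close> when \<open>X\<^sub>0\<close> is set
  to \<open>0\<close>, so \<open>P\<close> is a relation between \<open>p 1, \<dots>, p n\<close>, and hence \<open>P = 0\<close>.

  The real case is the complex one applied to real configurations: the inclusion of the reals
  into the complex numbers preserves genericity, and both preserves and reflects equality of
  squared distances.
\<close>

section \<open>Evaluation of rational polynomials\<close>

definition monom_eval :: "('i \<Rightarrow> 'a::field_char_0) \<Rightarrow> ('i \<Rightarrow>\<^sub>0 nat) \<Rightarrow> 'a" where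
  "monom_eval x m = (\<Prod>i\<in>Poly_Mapping.keys m. x i ^ Poly_Mapping.lookup m i)"

lemma mpoly_eval_monom_eval:
  "mpoly_eval x P =
     (\<Sum>m\<in>Poly_Mapping.keys P. of_rat (Poly_Mapping.lookup P m) * monom_eval x m)"
  by (simp add: mpoly_eval_def monom_eval_def)

lemma monom_eval_superset:
  assumes "finite S" "Poly_Mapping.keys m \<subseteq> S"
  shows "monom_eval x m = (\<Prod>i\<in>S. x i ^ Poly_Mapping.lookup m i)"
  unfolding monom_eval_def
  by (rule prod.mono_neutral_left) (use assms in \<open>auto simp: in_keys_iff\<close>)

lemma mpoly_eval_superset:
  assumes "finite S" "Poly_Mapping.keys P \<subseteq> S"
  shows "mpoly_eval x P = (\<Sum>m\<in>S. of_rat (Poly_Mapping.lookup P m) * monom_eval x m)"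
  unfolding mpoly_eval_monom_eval
  by (rule sum.mono_neutral_left) (use assms in \<open>auto simp: in_keys_iff\<close>)

lemma monom_eval_zero [simp]: "monom_eval x 0 = 1"
  by (simp add: monom_eval_def)

lemma monom_eval_single [simp]: "monom_eval x (Poly_Mapping.single i k) = x i ^ k"
  by (simp add: monom_eval_def)

lemma monom_eval_add: "monom_eval x (m + m') = monom_eval x m * monom_eval x m'"
proof -
  let ?S = "Poly_Mapping.keys m \<union> Poly_Mapping.keys m'"
  have "monom_eval x (m + m') = (\<Prod>i\<in>?S. x i ^ Poly_Mapping.lookup (m + m') i)"
    by (rule monom_eval_superset) (simp_all add: Poly_Mapping.keys_add)
  also have "\<dots> = monom_eval x m * monom_eval x m'"
    by (simp add: monom_eval_superset[of ?S] lookup_add power_add prod.distrib)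
  finally show ?thesis .
qed

lemma monom_eval_sum: "monom_eval x (\<Sum>a\<in>A. f a) = (\<Prod>a\<in>A. monom_eval x (f a))"
  by (induction A rule: infinite_finite_induct) (simp_all add: monom_eval_add)

lemma mpoly_eval_zero [simp]: "mpoly_eval x 0 = 0"
  by (simp add: mpoly_eval_monom_eval)

lemma mpoly_eval_single [simp]:
  "mpoly_eval x (Poly_Mapping.single m c) = of_rat c * monom_eval x m"
  by (simp add: mpoly_eval_monom_eval)

lemma mpoly_eval_add: "mpoly_eval x (P + Q) = mpoly_eval x P + mpoly_eval x Q"
proof -
  let ?S = "Poly_Mapping.keys P \<union> Poly_Mapping.keys Q"
  have "mpoly_eval x (P + Q) =
      (\<Sum>m\<in>?S. of_rat (Poly_Mapping.lookup (P + Q) m) * monom_eval x m)"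
    by (rule mpoly_eval_superset) (simp_all add: Poly_Mapping.keys_add)
  also have "\<dots> = mpoly_eval x P + mpoly_eval x Q"
    by (simp add: mpoly_eval_superset[of ?S] lookup_add of_rat_add distrib_right sum.distrib)
  finally show ?thesis .
qed

lemma mpoly_eval_sum: "mpoly_eval x (\<Sum>a\<in>A. f a) = (\<Sum>a\<in>A. mpoly_eval x (f a))"
  by (induction A rule: infinite_finite_induct) (simp_all add: mpoly_eval_add)

lemma sum_monomials:
  "(\<Sum>m\<in>Poly_Mapping.keys P. Poly_Mapping.single m (Poly_Mapping.lookup P m)) = P"
  by (rule poly_mapping_eqI) (simp add: lookup_sum lookup_single when_def in_keys_iff)

lemma mpoly_eval_mult: "mpoly_eval x (P * Q) = mpoly_eval x P * mpoly_eval x Q"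
proof -
  let ?c = Poly_Mapping.lookup
  have "P * Q = (\<Sum>m\<in>Poly_Mapping.keys P. Poly_Mapping.single m (?c P m)) *
      (\<Sum>m'\<in>Poly_Mapping.keys Q. Poly_Mapping.single m' (?c Q m'))"
    by (simp add: sum_monomials)
  also have "\<dots> = (\<Sum>m\<in>Poly_Mapping.keys P. \<Sum>m'\<in>Poly_Mapping.keys Q.
      Poly_Mapping.single (m + m') (?c P m * ?c Q m'))"
    by (simp add: sum_product mult_single)
  finally have "P * Q = \<dots>" .
  then have "mpoly_eval x (P * Q) =
      (\<Sum>m\<in>Poly_Mapping.keys P. \<Sum>m'\<in>Poly_Mapping.keys Q.
        of_rat (?c P m * ?c Q m') * monom_eval x (m + m'))"
    by (simp add: mpoly_eval_sum)
  also have "\<dots> = mpoly_eval x P * mpoly_eval x Q"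
    unfolding mpoly_eval_monom_eval sum_product
    by (intro sum.cong refl) (simp add: of_rat_mult monom_eval_add)
  finally show ?thesis .
qed

lemma mpoly_eval_cong:
  assumes "\<And>i. i \<in> mpoly_vars P \<Longrightarrow> x i = y i"
  shows "mpoly_eval x P = mpoly_eval y P"
proof -
  have "x i = y i" if "m \<in> Poly_Mapping.keys P" "i \<in> Poly_Mapping.keys m" for m i
    using assms that unfolding mpoly_vars_def by blast
  then show ?thesis
    by (simp add: mpoly_eval_def)
qed

lemma mpoly_vars_add: "mpoly_vars (P + Q) \<subseteq> mpoly_vars P \<union> mpoly_vars Q"
  using Poly_Mapping.keys_add[of P Q] by (auto simp: mpoly_vars_def)

lemma mpoly_vars_mult: "mpoly_vars (P * Q) \<subseteq> mpoly_vars P \<union> mpoly_vars Q"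
proof
  fix i assume "i \<in> mpoly_vars (P * Q)"
  then obtain m where m: "m \<in> Poly_Mapping.keys (P * Q)" "i \<in> Poly_Mapping.keys m"
    by (auto simp: mpoly_vars_def)
  then obtain a b where "a \<in> Poly_Mapping.keys P" "b \<in> Poly_Mapping.keys Q" "m = a + b"
    using keys_mult[of P Q] by blast
  with m(2) show "i \<in> mpoly_vars P \<union> mpoly_vars Q"
    using Poly_Mapping.keys_add[of a b] by (auto simp: mpoly_vars_def)
qed

section \<open>Substitution of polynomial functions\<close>

text \<open>
  Working with functions that some rational polynomial represents makes substitution a matter
  of closure properties, so that the substituted polynomial never has to be written down.
\<close>

definition rat_poly_fun :: "'i set \<Rightarrow> (('i \<Rightarrow> 'a::field_char_0) \<Rightarrow> 'a) \<Rightarrow> bool" where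
  "rat_poly_fun I f \<longleftrightarrow> (\<exists>Q. mpoly_vars Q \<subseteq> I \<and> (\<forall>x. mpoly_eval x Q = f x))"

lemma rat_poly_funI:
  assumes "mpoly_vars Q \<subseteq> I" "\<And>x. mpoly_eval x Q = f x"
  shows "rat_poly_fun I f"
  using assms unfolding rat_poly_fun_def by blast

lemma rat_poly_fun_const: "rat_poly_fun I (\<lambda>x. of_rat c)"
  by (rule rat_poly_funI[of "Poly_Mapping.single 0 c"]) (auto simp: mpoly_vars_def)

lemma rat_poly_fun_var:
  assumes "i \<in> I"
  shows "rat_poly_fun I (\<lambda>x. x i)"
  by (rule rat_poly_funI[of "Poly_Mapping.single (Poly_Mapping.single i 1) 1"])
     (use assms in \<open>auto simp: mpoly_vars_def\<close>)

lemma rat_poly_fun_add: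
  assumes "rat_poly_fun I f" "rat_poly_fun I g"
  shows "rat_poly_fun I (\<lambda>x. f x + g x)"
proof -
  obtain P Q where "mpoly_vars P \<subseteq> I" "\<And>x. mpoly_eval x P = f x"
      "mpoly_vars Q \<subseteq> I" "\<And>x. mpoly_eval x Q = g x"
    using assms unfolding rat_poly_fun_def by blast
  then show ?thesis
    using mpoly_vars_add[of P Q] by (intro rat_poly_funI[of "P + Q"]) (auto simp: mpoly_eval_add)
qed

lemma rat_poly_fun_mult:
  assumes "rat_poly_fun I f" "rat_poly_fun I g"
  shows "rat_poly_fun I (\<lambda>x. f x * g x)"
proof -
  obtain P Q where "mpoly_vars P \<subseteq> I" "\<And>x. mpoly_eval x P = f x"
      "mpoly_vars Q \<subseteq> I" "\<And>x. mpoly_eval x Q = g x"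
    using assms unfolding rat_poly_fun_def by blast
  then show ?thesis
    using mpoly_vars_mult[of P Q]
    by (intro rat_poly_funI[of "P * Q"]) (auto simp: mpoly_eval_mult)
qed

lemma rat_poly_fun_diff:
  assumes "rat_poly_fun I f" "rat_poly_fun I g"
  shows "rat_poly_fun I (\<lambda>x. f x - g x)"
  using rat_poly_fun_add[OF assms(1) rat_poly_fun_mult[OF rat_poly_fun_const[of I "-1"] assms(2)]]
  by (simp add: of_rat_minus)

lemma rat_poly_fun_power:
  assumes "rat_poly_fun I f"
  shows "rat_poly_fun I (\<lambda>x. f x ^ k)"
  using rat_poly_fun_const[of I 1] by (induction k) (auto intro: rat_poly_fun_mult assms)

lemma rat_poly_fun_sum:
  assumes "\<And>a. a \<in> A \<Longrightarrow> rat_poly_fun I (f a)"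
  shows "rat_poly_fun I (\<lambda>x. \<Sum>a\<in>A. f a x)"
  using assms rat_poly_fun_const[of I 0]
  by (induction A rule: infinite_finite_induct) (auto intro!: rat_poly_fun_add)

lemma rat_poly_fun_prod:
  assumes "\<And>a. a \<in> A \<Longrightarrow> rat_poly_fun I (f a)"
  shows "rat_poly_fun I (\<lambda>x. \<Prod>a\<in>A. f a x)"
  using assms rat_poly_fun_const[of I 1]
  by (induction A rule: infinite_finite_induct) (auto intro!: rat_poly_fun_mult)

lemma rat_poly_fun_substitute:
  assumes "\<And>i. i \<in> mpoly_vars P \<Longrightarrow> rat_poly_fun I (g i)"
  shows "rat_poly_fun I (\<lambda>x. mpoly_eval (\<lambda>i. g i x) P)"
  unfolding mpoly_eval_def
  by (intro rat_poly_fun_sum rat_poly_fun_mult rat_poly_fun_const rat_poly_fun_prod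
      rat_poly_fun_power assms) (auto simp: mpoly_vars_def)

section \<open>Algebraic independence\<close>

text \<open>
  The function \<open>x \<mapsto> P (x i - x v)\<^sub>i\<close> is represented by a rational polynomial \<open>Q\<close> at all points
  simultaneously. A relation at \<open>p\<close> makes \<open>Q\<close> the zero polynomial, so \<open>Q\<close> may be evaluated
  wherever this is useful, in particular where the coordinate \<open>v\<close> is zero.
\<close>

lemma alg_indep_rat_differences:
  fixes p :: "'i \<Rightarrow> 'a::field_char_0"
  assumes indep: "alg_indep_rat (insert v I) p" and v: "v \<notin> I"
  shows "alg_indep_rat I (\<lambda>i. p i - p v)"
  unfolding alg_indep_rat_def
proof (intro allI impI notI, elim conjE)
  fix P :: "'i rat_mpoly"
  assume P: "mpoly_vars P \<subseteq> I" "P \<noteq> 0" and relation: "mpoly_eval (\<lambda>i. p i - p v) P = 0"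
  have "rat_poly_fun (insert v I) (\<lambda>x::'i \<Rightarrow> 'a. mpoly_eval (\<lambda>i. x i - x v) P)"
    using P(1) by (intro rat_poly_fun_substitute rat_poly_fun_diff rat_poly_fun_var) auto
  then obtain Q where Q: "mpoly_vars Q \<subseteq> insert v I"
      "\<And>x :: 'i \<Rightarrow> 'a. mpoly_eval x Q = mpoly_eval (\<lambda>i. x i - x v) P"
    unfolding rat_poly_fun_def by blast
  have "Q = 0"
    using indep Q(1) Q(2)[of p] relation by (auto simp: alg_indep_rat_def)
  (* P does not involve v, so it cannot tell p from the point where the coordinate v is zero. *)
  have "mpoly_eval p P = mpoly_eval (\<lambda>i. (p(v := 0)) i - (p(v := 0)) v) P"
    by (rule mpoly_eval_cong) (use P(1) v in auto)
  also have "\<dots> = 0"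
    using Q(2)[of "p(v := 0)"] \<open>Q = 0\<close> by simp
  finally show False
    using indep P by (auto simp: alg_indep_rat_def)
qed

text \<open>
  A polynomial in the re-indexed variables is transported along \<open>f\<close> monomial by monomial.
  Injectivity of \<open>f\<close> keeps distinct monomials distinct, so no coefficients cancel and the
  transported polynomial is again nonzero.
\<close>

lemma alg_indep_rat_reindex:
  fixes x :: "'j \<Rightarrow> 'a::field_char_0" and f :: "'i \<Rightarrow> 'j"
  assumes indep: "alg_indep_rat (f ` I) x" and inj: "inj_on f I"
  shows "alg_indep_rat I (\<lambda>i. x (f i))"
  unfolding alg_indep_rat_def
proof (intro allI impI, elim conjE)
  fix P :: "'i rat_mpoly"
  assume P: "mpoly_vars P \<subseteq> I" "P \<noteq> 0"
  define r :: "('i \<Rightarrow>\<^sub>0 nat) \<Rightarrow> ('j \<Rightarrow>\<^sub>0 nat)" where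
    "r m = (\<Sum>i\<in>Poly_Mapping.keys m. Poly_Mapping.single (f i) (Poly_Mapping.lookup m i))" for m
  define Q where
    "Q = (\<Sum>m\<in>Poly_Mapping.keys P. Poly_Mapping.single (r m) (Poly_Mapping.lookup P m))"
  have keys_I: "Poly_Mapping.keys m \<subseteq> I" if "m \<in> Poly_Mapping.keys P" for m
    using P(1) that by (auto simp: mpoly_vars_def)
  have lookup_r: "Poly_Mapping.lookup (r m) (f i) = Poly_Mapping.lookup m i"
    if m: "m \<in> Poly_Mapping.keys P" and i: "i \<in> I" for m i
  proof -
    have "Poly_Mapping.lookup (r m) (f i) =
        (\<Sum>k\<in>Poly_Mapping.keys m. if k = i then Poly_Mapping.lookup m k else 0)"
      unfolding r_def lookup_sum lookup_single when_def
      by (intro sum.cong refl) (use keys_I[OF m] i inj in \<open>auto simp: inj_on_def\<close>)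
    then show ?thesis by (simp add: in_keys_iff)
  qed
  have inj_r: "m = m'"
    if "m \<in> Poly_Mapping.keys P" "m' \<in> Poly_Mapping.keys P" "r m = r m'" for m m'
  proof (rule poly_mapping_eqI)
    fix i
    show "Poly_Mapping.lookup m i = Poly_Mapping.lookup m' i"
    proof (cases "i \<in> I")
      case True
      then show ?thesis using lookup_r that by metis
    next
      case False
      then have "i \<notin> Poly_Mapping.keys m" "i \<notin> Poly_Mapping.keys m'"
        using keys_I that by auto
      then show ?thesis by (simp add: in_keys_iff)
    qed
  qed
  obtain m where m: "m \<in> Poly_Mapping.keys P"
    using P(2) by fastforce
  have "Poly_Mapping.lookup Q (r m) =
      (\<Sum>m'\<in>Poly_Mapping.keys P. if m' = m then Poly_Mapping.lookup P m' else 0)"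
    unfolding Q_def lookup_sum lookup_single when_def
    by (intro sum.cong refl) (use inj_r m in auto)
  then have "Poly_Mapping.lookup Q (r m) \<noteq> 0"
    using m by (simp add: in_keys_iff)
  then have "Q \<noteq> 0" by auto
  have keys_r: "Poly_Mapping.keys (r m) \<subseteq> f ` Poly_Mapping.keys m" for m
    unfolding r_def by (rule order_trans[OF keys_sum]) auto
  have "Poly_Mapping.keys Q \<subseteq> r ` Poly_Mapping.keys P"
    unfolding Q_def by (rule order_trans[OF keys_sum]) auto
  then have "mpoly_vars Q \<subseteq> f ` I"
    using keys_r keys_I unfolding mpoly_vars_def by blast
  with \<open>Q \<noteq> 0\<close> have "mpoly_eval x Q \<noteq> 0"
    using indep by (simp add: alg_indep_rat_def)
  moreover have "mpoly_eval x Q = mpoly_eval (\<lambda>i. x (f i)) P"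
    unfolding Q_def mpoly_eval_sum mpoly_eval_single
    by (simp add: r_def monom_eval_sum mpoly_eval_def)
  ultimately show "mpoly_eval (\<lambda>i. x (f i)) P \<noteq> 0" by simp
qed

lemma alg_indep_rat_complex_of_real:
  assumes "alg_indep_rat I p"
  shows "alg_indep_rat I (\<lambda>i. complex_of_real (p i))"
proof -
  have "complex_of_real (of_rat c) = of_rat c" for c
    by (cases c) (simp add: of_rat_rat)
  then have "mpoly_eval (\<lambda>i. complex_of_real (p i)) P = complex_of_real (mpoly_eval p P)" for P
    by (simp add: mpoly_eval_def)
  with assms show ?thesis by (simp add: alg_indep_rat_def)
qed

section \<open>Configurations as vectors\<close>

definition pinned_vec :: "nat \<Rightarrow> (nat \<Rightarrow> complex) \<Rightarrow> complex vec" where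
  "pinned_vec n p = vec n (\<lambda>i. p (Suc i) - p 0)"

lemma pinned_vec_carrier [simp]: "pinned_vec n p \<in> carrier_vec n"
  by (simp add: pinned_vec_def)

lemma generic_pinned_vec:
  assumes "alg_indep_rat {0..n} p"
  shows "generic_vec n (pinned_vec n p)"
proof -
  have "{0..n} = insert 0 (Suc ` {..<n})"
    by (simp add: lessThan_Suc_eq_insert_0[symmetric] lessThan_Suc_atMost atLeast0AtMost)
  then have "alg_indep_rat (Suc ` {..<n}) (\<lambda>i. p i - p 0)"
    using assms alg_indep_rat_differences[of 0 "Suc ` {..<n}" p] by simp
  then have indep: "alg_indep_rat {..<n} (\<lambda>i. p (Suc i) - p 0)"
    using alg_indep_rat_reindex[of Suc "{..<n}" "\<lambda>i. p i - p 0"] by simp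
  have "mpoly_eval (\<lambda>i. pinned_vec n p $ i) P = mpoly_eval (\<lambda>i. p (Suc i) - p 0) P"
    if "mpoly_vars P \<subseteq> {..<n}" for P
    by (rule mpoly_eval_cong) (use that in \<open>auto simp: pinned_vec_def\<close>)
  with indep show ?thesis
    by (simp add: generic_vec_def alg_indep_rat_def)
qed

lemma conjugate_std_basis: "conjugate (std_basis n i) = std_basis n i"
  by (rule eq_vecI) (auto simp: std_basis_def unit_vec_def)

lemma pinned_vec_std_basis:
  assumes "1 \<le> i" "i \<le> n"
  shows "pinned_vec n p \<bullet>c std_basis n i = p i - p 0"
  unfolding conjugate_std_basis using assms
  by (simp add: std_basis_def pinned_vec_def)

lemma pinned_vec_std_basis_diff:
  assumes "1 \<le> i" "i \<le> n" "1 \<le> j" "j \<le> n"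
  shows "pinned_vec n p \<bullet>c (std_basis n i - std_basis n j) = p i - p j"
proof -
  have carrier: "std_basis n k \<in> carrier_vec n" for k
    by (simp add: std_basis_def)
  have "conjugate (std_basis n i - std_basis n j) = std_basis n i - std_basis n j"
    by (rule eq_vecI) (auto simp: std_basis_def unit_vec_def)
  then have "pinned_vec n p \<bullet>c (std_basis n i - std_basis n j) =
      pinned_vec n p \<bullet>c std_basis n i - pinned_vec n p \<bullet>c std_basis n j"
    using carrier by (simp add: conjugate_std_basis scalar_prod_minus_distrib[of _ n])
  then show ?thesis
    using assms by (simp add: pinned_vec_std_basis)
qed

text \<open>
  Each ensemble vector contributes an edge to the graph. The squared length of that edge is the
  intensity of the pinned vector at the ensemble vector.
\<close>

lemma intensity_pinned_vec_eq:
  assumes ensemble: "\<phi> ` {..<M} \<subseteq> edge_vectors n"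
    and equiv: "equivalent_frameworks (ensemble_graph n (\<phi> ` {..<M})) p q"
  shows "intensity_vec M \<phi> (pinned_vec n p) = intensity_vec M \<phi> (pinned_vec n q)"
proof -
  have "(pinned_vec n p \<bullet>c \<phi> m)\<^sup>2 = (pinned_vec n q \<bullet>c \<phi> m)\<^sup>2" if "m < M" for m
  proof -
    have \<phi>m: "\<phi> m \<in> \<phi> ` {..<M}"
      using that by simp
    with ensemble have "\<phi> m \<in> edge_vectors n" by blast
    then consider i where "1 \<le> i" "i \<le> n" "\<phi> m = std_basis n i"
      | i j where "1 \<le> i" "i < j" "j \<le> n" "\<phi> m = std_basis n i - std_basis n j"
      unfolding edge_vectors_def by blast
    then show ?thesis
    proof cases
      case (1 i)
      then have "(i, 0) \<in> snd (ensemble_graph n (\<phi> ` {..<M}))"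
        using \<phi>m unfolding ensemble_graph_def by auto
      with equiv have "(p i - p 0)\<^sup>2 = (q i - q 0)\<^sup>2"
        by (auto simp: equivalent_frameworks_def sq_dist_def)
      with 1 show ?thesis by (simp add: pinned_vec_std_basis)
    next
      case (2 i j)
      then have "(i, j) \<in> snd (ensemble_graph n (\<phi> ` {..<M}))"
        using \<phi>m unfolding ensemble_graph_def by auto
      with equiv have "(p i - p j)\<^sup>2 = (q i - q j)\<^sup>2"
        by (auto simp: equivalent_frameworks_def sq_dist_def)
      with 2 show ?thesis by (simp add: pinned_vec_std_basis_diff)
    qed
  qed
  then show ?thesis
    unfolding intensity_vec_def by (intro eq_vecI) auto
qed

text \<open>
  If the pinned vectors agree up to sign, one configuration is the other followed by a translation
  or a point reflection, and both preserve
  squared distances.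
\<close>

lemma congruent_configs_pinned_vec:
  assumes "pinned_vec n q = pinned_vec n p \<or> pinned_vec n q = - pinned_vec n p"
    and "fst G = {0..n}"
  shows "congruent_configs G p q"
proof -
  obtain s :: complex where s: "s\<^sup>2 = 1" "\<And>k. k < n \<Longrightarrow> pinned_vec n q $ k = s * pinned_vec n p $ k"
  proof (cases "pinned_vec n q = pinned_vec n p")
    case True
    then show ?thesis by (intro that[of 1]) auto
  next
    case False
    then have "pinned_vec n q = - pinned_vec n p" using assms(1) by blast
    then show ?thesis by (intro that[of "-1"]) (auto simp: pinned_vec_def)
  qed
  have from_0: "q i - q 0 = s * (p i - p 0)" if "i \<le> n" for i
    using that s(2)[of "i - 1"] by (cases i) (auto simp: pinned_vec_def)
  have scaled: "q i - q j = s * (p i - p j)" if "i \<le> n" "j \<le> n" for i j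
  proof -
    have "q i - q j = (q i - q 0) - (q j - q 0)" by simp
    also have "\<dots> = s * (p i - p j)"
      using that by (simp add: from_0 algebra_simps)
    finally show ?thesis .
  qed
  show ?thesis
    unfolding congruent_configs_def sq_dist_def assms(2)
    using s(1) by (simp add: scaled power_mult_distrib)
qed

section \<open>Generic global rigidity\<close>

lemma injective_on_generic_sign:
  assumes "injective_on_generic n M \<phi>" "\<And>m. m < M \<Longrightarrow> \<phi> m \<in> carrier_vec n"
    and "generic_vec n x" "y \<in> carrier_vec n"
    and "intensity_vec M \<phi> x = intensity_vec M \<phi> y"
  shows "y = x \<or> y = - x"
proof -
  have x: "x \<in> carrier_vec n"
    using assms(3) by (simp add: generic_vec_def)
  have "pm_class n y \<in> pm_space n"
    unfolding pm_space_def pm_class_def using assms(4) by (rule quotientI)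
  moreover have "intensity M \<phi> (pm_class n y) = intensity M \<phi> (pm_class n x)"
    using assms(2,4,5) x by (simp add: intensity_pm_class)
  ultimately have "pm_class n y = pm_class n x"
    using assms(1,3) unfolding injective_on_generic_def by blast
  then show ?thesis
    using x assms(4) by (auto simp: pm_class_eq)
qed

lemma generically_globally_rigid_complex:
  fixes \<phi> :: "nat \<Rightarrow> complex vec"
  assumes ensemble: "\<phi> ` {..<M} \<subseteq> edge_vectors n"
    and inj: "injective_on_generic n M \<phi>"
  shows "generically_globally_rigid TYPE(complex) (ensemble_graph n (\<phi> ` {..<M}))"
  unfolding generically_globally_rigid_def globally_rigid_def
proof (intro allI impI)
  let ?G = "ensemble_graph n (\<phi> ` {..<M})"
  fix p q :: "nat \<Rightarrow> complex"
  assume generic: "generic_config ?G p" and equiv: "equivalent_frameworks ?G p q"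
  have vertices: "fst ?G = {0..n}"
    by (simp add: ensemble_graph_def)
  have "edge_vectors n \<subseteq> carrier_vec n"
    by (auto simp: edge_vectors_def std_basis_def)
  with ensemble have "\<phi> m \<in> carrier_vec n" if "m < M" for m
    using that by blast
  then have "pinned_vec n q = pinned_vec n p \<or> pinned_vec n q = - pinned_vec n p"
    using injective_on_generic_sign[OF inj _ generic_pinned_vec pinned_vec_carrier]
      intensity_pinned_vec_eq[OF ensemble equiv] generic
    by (simp add: generic_config_def vertices)
  then show "congruent_configs ?G p q"
    using vertices by (rule congruent_configs_pinned_vec)
qed

lemma sq_dist_complex_of_real:
  "sq_dist (complex_of_real a) (complex_of_real b) = complex_of_real (sq_dist a b)"
  by (simp add: sq_dist_def)

lemma generically_globally_rigid_real_if_complex: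
  assumes "generically_globally_rigid TYPE(complex) G"
  shows "generically_globally_rigid TYPE(real) G"
  unfolding generically_globally_rigid_def globally_rigid_def
proof (intro allI impI)
  fix p q :: "_ \<Rightarrow> real"
  assume "generic_config G p" "equivalent_frameworks G p q"
  then have "generic_config G (\<lambda>i. complex_of_real (p i))"
      "equivalent_frameworks G (\<lambda>i. complex_of_real (p i)) (\<lambda>i. complex_of_real (q i))"
    by (auto simp: generic_config_def alg_indep_rat_complex_of_real equivalent_frameworks_def
        sq_dist_complex_of_real)
  then have "congruent_configs G (\<lambda>i. complex_of_real (p i)) (\<lambda>i. complex_of_real (q i))"
    using assms unfolding generically_globally_rigid_def globally_rigid_def by blast
  then show "congruent_configs G p q"
    by (simp add: congruent_configs_def sq_dist_complex_of_real)
qed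

theorem theorem6:
  fixes n M :: nat and \<phi> :: "nat \<Rightarrow> complex vec"
  assumes "n \<ge> 1"
    and "\<phi> ` {..<M} \<subseteq> edge_vectors n"
    and "injective_on_generic n M \<phi>"
  shows "generically_globally_rigid TYPE(complex) (ensemble_graph n (\<phi> ` {..<M}))
       \<and> generically_globally_rigid TYPE(real) (ensemble_graph n (\<phi> ` {..<M}))"
  using generically_globally_rigid_complex[OF assms(2,3)]
  by (simp add: generically_globally_rigid_real_if_complex)

end
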